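(* Let $d=(d_n)_{n\ge0}$ be a monotonic increasing, unbounded sequence of positive real numbers such that $\lim_{n\to\infty}\frac{d_{n+1}}{d_n}=r$ for some real number $r$. Let $a=(a_n)_{n\ge0}$ be a complex sequence with $a_0\ne0$, $a_1\neq0$ such that $T_a$ is a bounded linear operator on $h_d$ and such that the power series $\Phi_a(z)=\sum_{n=0}^\infty a_nz^n$ is analytic on some neighbourhood of $\overline{\mathbb D}_r$. Then $$\sigma(T_a,h_d)=\Phi_a(\overline{\mathbb D}_r).$$
   Context: All sequences are complex and indexed by $\mathbb N_0=\{0,1,2,\dots\}$. The weighted Hahn space is $h_d=\{x\in\mathbb C^{\mathbb N_0}:\sum_{n=0}^\infty d_n|x_n-x_{n+1}|<\infty,\ \lim_n x_n=0\}$ with norm $\|x\|_{h_d}=\sum_{n=0}^\infty d_n|x_n-x_{n+1}|$; it is a Banach space. The convolution is $(a*x)_n=\sum_{k=0}^n a_{n-k}x_k$, and $T_a(x)=a*x$. $\mathbb D_r$ is the open disk in $\mathbb C$ centered at $0$ of radius $r$ and $\overline{\mathbb D}_r$ its closure. $\Phi_a$ being analytic on a neighbourhood of $\overline{\mathbb D}_r$ means the power series converges there to an analytic function. $\sigma(T,X)$ is the spectrum of $T$ as a bounded operator on the Banach space $X$. *)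

theory Defs
  imports "HOL-Analysis.Analysis"
begin

definition hahn_space :: "(nat \<Rightarrow> real) \<Rightarrow> (nat \<Rightarrow> complex) set" where
  "hahn_space d =
     {x. summable (\<lambda>n. d n * cmod (x n - x (Suc n))) \<and> x \<longlonglongrightarrow> 0}"

definition hahn_norm :: "(nat \<Rightarrow> real) \<Rightarrow> (nat \<Rightarrow> complex) \<Rightarrow> real" where
  "hahn_norm d x = (\<Sum>n. d n * cmod (x n - x (Suc n)))"

definition convolution_op :: "(nat \<Rightarrow> complex) \<Rightarrow> (nat \<Rightarrow> complex) \<Rightarrow> (nat \<Rightarrow> complex)" where
  "convolution_op a x = (\<lambda>n. \<Sum>k\<le>n. a (n - k) * x k)"

definition symbol :: "(nat \<Rightarrow> complex) \<Rightarrow> complex \<Rightarrow> complex" where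
  "symbol a z = (\<Sum>n. a n * z ^ n)"

(* Because suminf is total, convergence of the series has to be required
   separately from analyticity of its sum. *)
definition symbol_analytic_near :: "(nat \<Rightarrow> complex) \<Rightarrow> complex set \<Rightarrow> bool" where
  "symbol_analytic_near a K \<longleftrightarrow>
     (\<exists>U. open U \<and> K \<subseteq> U \<and> (\<forall>z\<in>U. summable (\<lambda>n. a n * z ^ n)) \<and> symbol a analytic_on U)"

(* The space h_d depends on the sequence d, so it cannot be a type of a normed
   vector space class. A normed sequence space is given instead by its carrier X and
   its norm N, and an operator on it by a map on all sequences of which only the
   restriction to X matters. *)
definition bounded_operator_on ::
  "(nat \<Rightarrow> complex) set \<Rightarrow> ((nat \<Rightarrow> complex) \<Rightarrow> real) \<Rightarrow>
   ((nat \<Rightarrow> complex) \<Rightarrow> (nat \<Rightarrow> complex)) \<Rightarrow> bool" where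
  "bounded_operator_on X N T \<longleftrightarrow>
     (\<forall>x\<in>X. T x \<in> X) \<and>
     (\<forall>x\<in>X. \<forall>y\<in>X. T (\<lambda>n. x n + y n) = (\<lambda>n. T x n + T y n)) \<and>
     (\<forall>c. \<forall>x\<in>X. T (\<lambda>n. c * x n) = (\<lambda>n. c * T x n)) \<and>
     (\<exists>C. \<forall>x\<in>X. N (T x) \<le> C * N x)"

(* Those c for which c I - T has no two-sided inverse among the bounded linear
   operators on (X, N). *)
definition op_spectrum ::
  "(nat \<Rightarrow> complex) set \<Rightarrow> ((nat \<Rightarrow> complex) \<Rightarrow> real) \<Rightarrow>
   ((nat \<Rightarrow> complex) \<Rightarrow> (nat \<Rightarrow> complex)) \<Rightarrow> complex set" where
  "op_spectrum X N T =
     {c. \<not> (\<exists>S. bounded_operator_on X N S \<and>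
               (\<forall>x\<in>X. S (\<lambda>n. c * x n - T x n) = x) \<and>
               (\<forall>x\<in>X. (\<lambda>n. c * S x n - T (S x) n) = x))}"

end

theory Submission
  imports Defs "HOL-Complex_Analysis.Cauchy_Integral_Formula"
begin

text \<open>
  If \<open>\<Phi>\<^sub>a - c\<close> has no zero on the closed disk, the coefficients \<open>b\<close> of
  \<open>1 / (c - \<Phi>\<^sub>a)\<close> still satisfy \<open>\<Sum> \<bar>b\<^sub>k\<bar> \<rho>\<^sup>k < \<infinity>\<close> for some \<open>\<rho> > r\<close>. Since
  \<open>d\<^sub>n\<^sub>+\<^sub>k \<le> C \<rho>\<^sup>k d\<^sub>n\<close>, convolution with \<open>b\<close> is bounded on \<open>h\<^sub>d\<close> and inverts \<open>c - T\<^sub>a\<close>.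

  Conversely, for \<open>\<bar>\<lambda>\<bar> < r\<close> the bounded functional \<open>f(x) = \<Sum> x\<^sub>n \<lambda>\<^sup>n\<close> is an eigenvector of the
  adjoint of \<open>T\<^sub>a\<close> for the eigenvalue \<open>\<Phi>\<^sub>a(\<lambda>)\<close>. If \<open>c - T\<^sub>a\<close> had a bounded inverse \<open>S\<close>, then
  \<open>f = (c - \<Phi>\<^sub>a(\<lambda>)) f \<circ> S\<close>, which is impossible as soon as \<open>\<Phi>\<^sub>a(\<lambda>)\<close> is close enough to \<open>c\<close>.
  Choosing \<open>\<lambda>\<close> in the open disk near a given point of the closed disk covers the boundary as well.
\<close>

section \<open>Weights: pointwise decay and growth estimates\<close>

text \<open>Telescoping from \<open>n\<close> to \<open>n + m\<close>: since \<open>d\<close>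
  increases, each later increment carries a weight of at least \<open>d n\<close>. Letting
  \<open>m\<close> tend to infinity removes \<open>x (n + m)\<close>, because \<open>x\<close> is a
  null sequence.\<close>

lemma hahn_space_weighted_bound:
  assumes pos: "\<And>n. 0 < d n" and inc: "incseq d" and x: "x \<in> hahn_space d"
  shows "d n * cmod (x n) \<le> hahn_norm d x"
proof -
  have s: "summable (\<lambda>n. d n * cmod (x n - x (Suc n)))" and lim: "x \<longlonglongrightarrow> 0"
    using x by (auto simp: hahn_space_def)
  have d0: "0 \<le> d k" for k using pos[of k] by simp
  have part: "d n * cmod (x n - x (n + m)) \<le> (\<Sum>k<n+m. d k * cmod (x k - x (Suc k)))" for m
  proof (induction m)
    case 0
    then show ?case by (simp add: sum_nonneg d0)
  next
    case (Suc m)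
    have "d n * cmod (x n - x (n + Suc m))
        \<le> d n * (cmod (x n - x (n + m)) + cmod (x (n + m) - x (Suc (n + m))))"
      by (intro mult_left_mono d0) (use norm_triangle_ineq[of "x n - x (n + m)" "x (n + m) - x (Suc (n + m))"] in simp)
    also have "\<dots> \<le> d n * cmod (x n - x (n + m)) + d (n + m) * cmod (x (n + m) - x (Suc (n + m)))"
      using mult_right_mono[OF incseqD[OF inc, of n "n + m"], of "cmod (x (n + m) - x (Suc (n + m)))"]
      by (simp add: distrib_left)
    finally show ?case using Suc by simp
  qed
  have bound: "d n * cmod (x n - x (n + m)) \<le> hahn_norm d x" for m
    using part[of m] sum_le_suminf[OF s, of "{..<n+m}"] d0
    unfolding hahn_norm_def by (fastforce intro: order_trans)
  have "(\<lambda>m. x (m + n)) \<longlonglongrightarrow> 0"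
    using lim by (rule LIMSEQ_ignore_initial_segment)
  then have "(\<lambda>m. d n * cmod (x n - x (n + m))) \<longlonglongrightarrow> d n * cmod (x n - 0)"
    by (intro tendsto_intros) (simp add: add.commute)
  then show ?thesis
    using bound by (auto intro: LIMSEQ_le_const2)
qed

lemma ratio_limit_ge_1:
  fixes d :: "nat \<Rightarrow> real"
  assumes pos: "\<And>n. 0 < d n" and inc: "incseq d" and lim: "(\<lambda>n. d (Suc n) / d n) \<longlonglongrightarrow> r"
  shows "1 \<le> r"
proof -
  have "1 \<le> d (Suc n) / d n" for n
    using incseq_SucD[OF inc, of n] pos[of n] by simp
  then show ?thesis by (intro LIMSEQ_le_const[OF lim]) auto
qed

text \<open>Ratios are below \<rho> from some index on; the finitely many earlier ones cost only a
  bounded factor. The constant is uniform in \<open>n\<close> and \<open>k\<close>, which lets a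
  weight be split across a convolution.\<close>

lemma ratio_growth_bound:
  fixes d :: "nat \<Rightarrow> real"
  assumes pos: "\<And>n. 0 < d n" and inc: "incseq d"
    and lim: "(\<lambda>n. d (Suc n) / d n) \<longlonglongrightarrow> r" and \<rho>: "r < \<rho>"
  obtains C where "0 < C" "\<And>n k. d (n + k) \<le> C * \<rho> ^ k * d n"
proof -
  have "0 \<le> \<rho>" using ratio_limit_ge_1[OF pos inc lim] \<rho> by simp
  obtain N where N: "\<And>n. N \<le> n \<Longrightarrow> d (Suc n) / d n < \<rho>"
    using order_tendstoD(2)[OF lim \<rho>] by (auto simp: eventually_sequentially)
  have step: "d (Suc n) \<le> \<rho> * d n" if "N \<le> n" for n
    using N[OF that] pos[of n] by (simp add: divide_simps)
  have "Bseq (\<lambda>n. d (Suc n) / d n)"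
    using lim by (intro convergent_imp_Bseq convergentI)
  then obtain B where "0 < B" and B: "\<And>n. norm (d (Suc n) / d n) \<le> B"
    by (rule BseqE) blast
  have B': "d (Suc n) \<le> B * d n" for n
    using B[of n] pos[of n] pos[of "Suc n"] by (simp add: divide_simps)
  have 1: "d (n + k) \<le> B ^ k * d n" for n k
  proof (induction k)
    case (Suc k)
    have "d (n + Suc k) \<le> B * d (n + k)" using B'[of "n + k"] by simp
    also have "\<dots> \<le> B * (B ^ k * d n)" using Suc \<open>0 < B\<close> by (intro mult_left_mono) auto
    finally show ?case by (simp add: mult_ac)
  qed simp
  have 2: "d (n + k) \<le> \<rho> ^ k * d n" if "N \<le> n" for n k
  proof (induction k)
    case (Suc k)
    have "d (n + Suc k) \<le> \<rho> * d (n + k)" using step[of "n + k"] that by simp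
    also have "\<dots> \<le> \<rho> * (\<rho> ^ k * d n)" using Suc \<open>0 \<le> \<rho>\<close> by (intro mult_left_mono) auto
    finally show ?case by (simp add: mult_ac)
  qed simp
  \<comment> \<open>Monotonicity inserts \<open>N\<close> extra steps, so that the \<open>k\<close>
    steps with factor \<rho> start at \<open>n + N\<close>; returning from \<open>n + N\<close> to
    \<open>n\<close> costs \<open>B ^ N\<close>.\<close>
  have "d (n + k) \<le> B ^ N * \<rho> ^ k * d n" for n k
  proof -
    have "d (n + k) \<le> d (n + N + k)" by (intro incseqD[OF inc]) simp
    also have "\<dots> \<le> \<rho> ^ k * d (n + N)" by (rule 2) simp
    also have "\<dots> \<le> \<rho> ^ k * (B ^ N * d n)" using 1[of n N] \<open>0 \<le> \<rho>\<close> by (intro mult_left_mono) auto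
    finally show ?thesis by (simp add: mult_ac)
  qed
  with \<open>0 < B\<close> show thesis by (intro that[of "B ^ N"]) auto
qed

section \<open>Convolution as multiplication of formal power series, and its boundedness\<close>

text \<open>Turns inversion of \<open>c - T_a\<close> into inversion in a commutative ring, with no
  convergence question at this stage.\<close>

lemma convolution_op_eq_fps_mult:
  "convolution_op a x = fps_nth (Abs_fps a * Abs_fps x)"
proof
  fix n
  have "fps_nth (Abs_fps a * Abs_fps x) n = fps_nth (Abs_fps x * Abs_fps a) n"
    by (simp only: mult.commute)
  also have "\<dots> = (\<Sum>k\<le>n. x k * a (n - k))"
    by (simp add: fps_mult_nth atLeast0AtMost)
  also have "\<dots> = convolution_op a x n"
    unfolding convolution_op_def by (intro sum.cong refl mult.commute)
  finally show "convolution_op a x n = fps_nth (Abs_fps a * Abs_fps x) n" by simp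
qed

lemma resolvent_op_eq_fps_mult:
  "(\<lambda>n. c * x n - convolution_op a x n) = fps_nth ((fps_const c - Abs_fps a) * Abs_fps x)"
  by (rule ext) (simp add: convolution_op_eq_fps_mult left_diff_distrib)

text \<open>Differences of \<open>b * x\<close> are the convolution of \<open>b\<close> with the
  differences of \<open>x\<close>, up to a boundary term in \<open>x 0\<close>. Once the weight is
  split between the factors, the main part is a Cauchy product; it and the boundary part each
  contribute at most \<open>C * B\<close> times the norm.\<close>

lemma convolution_op_bounded:
  assumes pos: "\<And>n. 0 < d n" and inc: "incseq d" and unbdd: "\<not> bdd_above (range d)"
    and lim: "(\<lambda>n. d (Suc n) / d n) \<longlonglongrightarrow> r" and \<rho>: "r < \<rho>"
    and b: "summable (\<lambda>k. cmod (b k) * \<rho> ^ k)"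
  shows "bounded_operator_on (hahn_space d) (hahn_norm d) (convolution_op b)"
proof -
  define B where "B = (\<Sum>k. cmod (b k) * \<rho> ^ k)"
  obtain C where "0 < C" and C: "\<And>n k. d (n + k) \<le> C * \<rho> ^ k * d n"
    using ratio_growth_bound[OF pos inc lim \<rho>] by blast
  have "0 \<le> \<rho>" using ratio_limit_ge_1[OF pos inc lim] \<rho> by simp
  have d0: "0 \<le> d k" for k using pos[of k] by simp
  have nn: "0 \<le> cmod (b k) * \<rho> ^ k" for k using \<open>0 \<le> \<rho>\<close> by simp
  have "0 \<le> B" unfolding B_def by (intro suminf_nonneg b nn)
  \<comment> \<open>Moves the weight from index \<open>n\<close> to \<open>n - k\<close>; the price
    \<open>C * \<rho> ^ k\<close> is absorbed by the summability of \<open>b\<close>.\<close>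
  have weight: "cmod (b k) * (d n * t) \<le> C * (cmod (b k) * \<rho> ^ k * (d (n - k) * t))"
    if "k \<le> n" "0 \<le> t" for k n t
  proof -
    have "d n \<le> C * \<rho> ^ k * d (n - k)" using C[of "n - k" k] that by simp
    then have "cmod (b k) * (d n * t) \<le> cmod (b k) * (C * \<rho> ^ k * d (n - k) * t)"
      using that by (intro mult_left_mono mult_right_mono) auto
    then show ?thesis by (simp add: mult_ac)
  qed
  have conv: "convolution_op b x n = (\<Sum>k\<le>n. b k * x (n - k))" for x n
    by (simp add: convolution_op_eq_fps_mult fps_mult_nth atLeast0AtMost)
  have main: "convolution_op b x \<in> hahn_space d \<and>
      hahn_norm d (convolution_op b x) \<le> 2 * C * B * hahn_norm d x" if x: "x \<in> hahn_space d" for x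
  proof -
    define T where "T = convolution_op b x"
    define y where "y n = x n - x (Suc n)" for n
    define N where "N = hahn_norm d x"
    have sy: "summable (\<lambda>n. d n * cmod (y n))" and Neq: "(\<Sum>n. d n * cmod (y n)) = N"
      using x by (auto simp: hahn_space_def y_def N_def hahn_norm_def)
    have wb: "d n * cmod (x n) \<le> N" for n
      unfolding N_def by (rule hahn_space_weighted_bound[OF pos inc x])
    have "0 \<le> N" using wb[of 0] d0[of 0] by (smt (verit) mult_nonneg_nonneg norm_ge_zero)
    \<comment> \<open>The sum for \<open>T (Suc n)\<close> has one more index,
      \<open>k = Suc n\<close>, whose term \<open>b (Suc n) * x 0\<close> has no partner in
      \<open>T n\<close>.\<close>
    have diff: "T n - T (Suc n) = (\<Sum>k\<le>n. b k * y (n - k)) - b (Suc n) * x 0" for n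
    proof -
      have "(\<Sum>k\<le>n. b k * y (n - k)) = (\<Sum>k\<le>n. b k * x (n - k)) - (\<Sum>k\<le>n. b k * x (Suc n - k))"
        by (simp add: y_def right_diff_distrib sum_subtractf Suc_diff_le)
      then show ?thesis by (simp add: T_def conv)
    qed
    define u where "u n = C * (\<Sum>k\<le>n. cmod (b k) * \<rho> ^ k * (d (n - k) * cmod (y (n - k))))
        + C * N * (cmod (b (Suc n)) * \<rho> ^ Suc n)" for n
    have diff_le: "d n * cmod (T n - T (Suc n)) \<le> u n" for n
    proof -
      have "d n * cmod (T n - T (Suc n))
          \<le> d n * ((\<Sum>k\<le>n. cmod (b k * y (n - k))) + cmod (b (Suc n) * x 0))"
        unfolding diff
        by (intro mult_left_mono d0 order_trans[OF norm_triangle_ineq4] add_mono norm_sum order_refl)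
      also have "\<dots> = (\<Sum>k\<le>n. cmod (b k) * (d n * cmod (y (n - k)))) + cmod (b (Suc n)) * (d n * cmod (x 0))"
        by (simp add: distrib_left sum_distrib_left norm_mult mult_ac)
      also have "\<dots> \<le> (\<Sum>k\<le>n. C * (cmod (b k) * \<rho> ^ k * (d (n - k) * cmod (y (n - k)))))
          + C * (cmod (b (Suc n)) * \<rho> ^ Suc n * N)"
      proof (intro add_mono sum_mono weight)
        \<comment> \<open>Raising \<open>d n\<close> to \<open>d (Suc n)\<close> lets
          \<open>weight\<close> apply with both indices equal to \<open>Suc n\<close>, which leaves
          \<open>d 0 * cmod (x 0)\<close>.\<close>
        have "cmod (b (Suc n)) * (d n * cmod (x 0)) \<le> cmod (b (Suc n)) * (d (Suc n) * cmod (x 0))"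
          using incseq_SucD[OF inc] by (intro mult_left_mono mult_right_mono) auto
        also have "\<dots> \<le> C * (cmod (b (Suc n)) * \<rho> ^ Suc n * (d 0 * cmod (x 0)))"
          using weight[of "Suc n" "Suc n" "cmod (x 0)"] by simp
        also have "\<dots> \<le> C * (cmod (b (Suc n)) * \<rho> ^ Suc n * N)"
          by (intro mult_left_mono wb nn less_imp_le[OF \<open>0 < C\<close>])
        finally show "cmod (b (Suc n)) * (d n * cmod (x 0)) \<le> C * (cmod (b (Suc n)) * \<rho> ^ Suc n * N)" .
      qed auto
      finally show ?thesis by (simp add: u_def sum_distrib_left mult_ac)
    qed
    have cp: "(\<lambda>n. \<Sum>k\<le>n. cmod (b k) * \<rho> ^ k * (d (n - k) * cmod (y (n - k)))) sums (B * N)"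
      using Cauchy_product_sums[of "\<lambda>k. cmod (b k) * \<rho> ^ k" "\<lambda>n. d n * cmod (y n)"] b sy d0 \<open>0 \<le> \<rho>\<close>
      by (simp add: B_def Neq)
    have shift: "(\<lambda>n. cmod (b (Suc n)) * \<rho> ^ Suc n) sums (B - cmod (b 0))"
      using summable_sums[OF b] sums_Suc_iff[of "\<lambda>n. cmod (b n) * \<rho> ^ n" "B - cmod (b 0)"]
      by (simp add: B_def)
    have u: "u sums (C * (B * N) + C * N * (B - cmod (b 0)))"
      unfolding u_def by (intro sums_add sums_mult cp shift)
    have sT: "summable (\<lambda>n. d n * cmod (T n - T (Suc n)))"
      using diff_le d0 by (intro summable_comparison_test'[OF sums_summable[OF u], of 0]) auto
    have "hahn_norm d T \<le> C * (B * N) + C * N * (B - cmod (b 0))"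
      unfolding hahn_norm_def sums_unique[OF u] by (intro suminf_le diff_le sT sums_summable[OF u])
    \<comment> \<open>The shifted series misses the term of \<open>b 0\<close>, which enters with a
      favourable sign and is dropped.\<close>
    also have "\<dots> \<le> 2 * C * B * N"
      using mult_nonneg_nonneg[OF mult_nonneg_nonneg[of C N] norm_ge_zero[of "b 0"]] \<open>0 < C\<close> \<open>0 \<le> N\<close>
      by (simp add: algebra_simps)
    finally have norm_le: "hahn_norm d T \<le> 2 * C * B * N" .
    \<comment> \<open>Membership also asks for a null sequence: \<open>d n * cmod (T n)\<close>
      stays bounded, and the unboundedness of \<open>d\<close> does the rest.\<close>
    have Tn: "cmod (T n) \<le> C * (B * N) / d n" for n
    proof -
      have "d n * cmod (T n) \<le> d n * (\<Sum>k\<le>n. cmod (b k * x (n - k)))"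
        unfolding T_def conv by (intro mult_left_mono d0 norm_sum)
      also have "\<dots> = (\<Sum>k\<le>n. cmod (b k) * (d n * cmod (x (n - k))))"
        by (simp add: sum_distrib_left norm_mult mult_ac)
      also have "\<dots> \<le> (\<Sum>k\<le>n. C * (cmod (b k) * \<rho> ^ k * (d (n - k) * cmod (x (n - k)))))"
        by (intro sum_mono weight) auto
      also have "\<dots> \<le> (\<Sum>k\<le>n. C * (cmod (b k) * \<rho> ^ k * N))"
        by (intro sum_mono mult_left_mono wb nn less_imp_le[OF \<open>0 < C\<close>])
      also have "\<dots> = C * ((\<Sum>k\<le>n. cmod (b k) * \<rho> ^ k) * N)"
        by (simp add: sum_distrib_left sum_distrib_right)
      also have "\<dots> \<le> C * (B * N)"
        unfolding B_def using \<open>0 < C\<close> \<open>0 \<le> N\<close> nn b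
        by (intro mult_left_mono mult_right_mono sum_le_suminf) auto
      finally show ?thesis using pos[of n] by (simp add: field_simps)
    qed
    have "filterlim d at_top sequentially"
      unfolding filterlim_at_top
    proof
      fix Z
      obtain m where "Z < d m" using unbdd by (auto simp: bdd_above_def not_le)
      then show "\<forall>\<^sub>F n in sequentially. Z \<le> d n"
        using incseqD[OF inc, of m] unfolding eventually_sequentially
        by (metis less_imp_le order_trans)
    qed
    then have "(\<lambda>n. C * (B * N) / d n) \<longlonglongrightarrow> 0"
      by (rule real_tendsto_divide_at_top[OF tendsto_const])
    then have "T \<longlonglongrightarrow> 0"
      by (rule Lim_null_comparison[rotated]) (simp add: Tn)
    with sT norm_le show ?thesis by (simp add: hahn_space_def T_def N_def)
  qed
  then show ?thesis
    unfolding bounded_operator_on_def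
    by (auto simp: convolution_op_def fun_eq_iff distrib_left sum.distrib sum_distrib_left mult_ac
        intro!: exI[of _ "2 * C * B"])
qed

section \<open>Point evaluations of the power series as bounded functionals\<close>

text \<open>Ratio test with \<open>q\<close> strictly between \<open>t\<close> and \<open>r\<close>:
  eventually consecutive terms have quotient at most \<open>t / q\<close>.\<close>

lemma summable_power_div_weight:
  fixes d :: "nat \<Rightarrow> real" and t :: real
  assumes pos: "\<And>n. 0 < d n" and inc: "incseq d"
    and lim: "(\<lambda>n. d (Suc n) / d n) \<longlonglongrightarrow> r" and t: "0 \<le> t" "t < r"
  shows "summable (\<lambda>n. t ^ n / d n)"
proof -
  obtain q where q: "t < q" "q < r" using dense t by blast
  obtain N where N: "\<And>n. N \<le> n \<Longrightarrow> q < d (Suc n) / d n"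
    using order_tendstoD(1)[OF lim q(2)] by (auto simp: eventually_sequentially)
  have "norm (t ^ Suc n / d (Suc n)) \<le> (t / q) * norm (t ^ n / d n)" if "N \<le> n" for n
  proof -
    have "q * d n \<le> d (Suc n)"
      using N[OF that] pos[of n] by (simp add: divide_simps mult.commute)
    then have "t ^ Suc n / d (Suc n) \<le> t ^ Suc n / (q * d n)"
      using pos[of n] pos[of "Suc n"] q t by (intro divide_left_mono mult_pos_pos) auto
    then show ?thesis using pos[of n] pos[of "Suc n"] t by simp
  qed
  then show ?thesis
    using q t by (intro summable_ratio_test[of "t / q" N]) auto
qed

lemma hahn_space_power_functional:
  assumes pos: "\<And>n. 0 < d n" and inc: "incseq d"
    and lim: "(\<lambda>n. d (Suc n) / d n) \<longlonglongrightarrow> r" and z: "cmod z < r"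
    and x: "x \<in> hahn_space d"
  shows "summable (\<lambda>n. norm (x n * z ^ n))"
    and "cmod (symbol x z) \<le> (\<Sum>n. cmod z ^ n / d n) * hahn_norm d x"
proof -
  have s: "summable (\<lambda>n. cmod z ^ n / d n * hahn_norm d x)"
    by (intro summable_mult2 summable_power_div_weight[OF pos inc lim]) (use z in auto)
  have le: "norm (x n * z ^ n) \<le> cmod z ^ n / d n * hahn_norm d x" for n
  proof -
    have "cmod (x n) \<le> hahn_norm d x / d n"
      using hahn_space_weighted_bound[OF pos inc x, of n] pos[of n] by (simp add: field_simps)
    from mult_right_mono[OF this, of "cmod z ^ n"] show ?thesis
      by (simp add: norm_mult norm_power mult_ac)
  qed
  show sx: "summable (\<lambda>n. norm (x n * z ^ n))"
    using le by (intro summable_comparison_test'[OF s, of 0]) auto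
  have "cmod (symbol x z) \<le> (\<Sum>n. norm (x n * z ^ n))"
    unfolding symbol_def by (rule summable_norm[OF sx])
  also have "\<dots> \<le> (\<Sum>n. cmod z ^ n / d n * hahn_norm d x)"
    by (intro suminf_le le sx s)
  also have "\<dots> = (\<Sum>n. cmod z ^ n / d n) * hahn_norm d x"
    by (intro suminf_mult2[symmetric] summable_power_div_weight[OF pos inc lim]) (use z in auto)
  finally show "cmod (symbol x z) \<le> (\<Sum>n. cmod z ^ n / d n) * hahn_norm d x" .
qed

text \<open>Evaluation at \<open>z\<close> is multiplicative by the Cauchy product; this is the
  eigenvector relation for the adjoint.\<close>

lemma symbol_resolvent_op:
  assumes a: "summable (\<lambda>n. norm (a n * z ^ n))" and x: "summable (\<lambda>n. norm (x n * z ^ n))"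
  shows "symbol (\<lambda>n. c * x n - convolution_op a x n) z = (c - symbol a z) * symbol x z"
proof -
  have eq: "(\<Sum>i\<le>n. (a i * z ^ i) * (x (n - i) * z ^ (n - i))) = convolution_op a x n * z ^ n" for n
  proof -
    have "(\<Sum>i\<le>n. (a i * z ^ i) * (x (n - i) * z ^ (n - i))) = (\<Sum>i\<le>n. a i * x (n - i) * z ^ n)"
      by (intro sum.cong refl) (auto simp: power_add[symmetric] mult_ac)
    then show ?thesis
      by (simp add: convolution_op_eq_fps_mult fps_mult_nth atLeast0AtMost sum_distrib_right)
  qed
  have "(\<lambda>n. convolution_op a x n * z ^ n) sums (symbol a z * symbol x z)"
    using Cauchy_product_sums[OF a x] unfolding eq symbol_def .
  moreover have "(\<lambda>n. c * (x n * z ^ n)) sums (c * symbol x z)"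
    unfolding symbol_def by (intro sums_mult summable_sums summable_norm_cancel[OF x])
  ultimately have "(\<lambda>n. c * (x n * z ^ n) - convolution_op a x n * z ^ n) sums
      (c * symbol x z - symbol a z * symbol x z)"
    by (intro sums_diff)
  then show ?thesis
    by (simp add: symbol_def[of "\<lambda>n. c * x n - convolution_op a x n"] sums_iff algebra_simps)
qed

text \<open>A test vector on which every point evaluation takes the value 1.\<close>

lemma unit_sequence_in_hahn_space: "(\<lambda>n. if n = 0 then 1 else 0) \<in> hahn_space d"
proof -
  have "summable (\<lambda>n. d n * cmod ((if n = 0 then 1 else 0) - (if Suc n = 0 then 1 else 0)))"
    by (rule summable_finite[of "{0}"]) auto
  moreover have "(\<lambda>n. if n = 0 then 1 else 0 :: complex) \<longlonglongrightarrow> 0"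
    by (rule LIMSEQ_offset[where k = 1]) simp
  ultimately show ?thesis by (simp add: hahn_space_def)
qed

section \<open>The two inclusions for the spectrum\<close>

lemma symbol_in_spectrum:
  assumes pos: "\<And>n. 0 < d n" and inc: "incseq d"
    and lim: "(\<lambda>n. d (Suc n) / d n) \<longlonglongrightarrow> r"
    and R: "r < R" "ereal R \<le> conv_radius a" and z: "cmod z \<le> r"
  shows "symbol a z \<in> op_spectrum (hahn_space d) (hahn_norm d) (convolution_op a)"
proof (rule ccontr)
  define c where "c = symbol a z"
  assume "\<not> ?thesis"
  then obtain S where S: "bounded_operator_on (hahn_space d) (hahn_norm d) S"
    and inv: "\<And>x. x \<in> hahn_space d \<Longrightarrow> (\<lambda>n. c * S x n - convolution_op a (S x) n) = x"
    unfolding op_spectrum_def c_def by blast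
  have SX: "S x \<in> hahn_space d" if "x \<in> hahn_space d" for x
    using S that by (auto simp: bounded_operator_on_def)
  obtain M0 where M0: "\<And>x. x \<in> hahn_space d \<Longrightarrow> hahn_norm d (S x) \<le> M0 * hahn_norm d x"
    using S unfolding bounded_operator_on_def by blast
  have nonneg: "0 \<le> hahn_norm d x" if "x \<in> hahn_space d" for x
    using hahn_space_weighted_bound[OF pos inc that, of 0] pos[of 0]
    by (smt (verit) mult_nonneg_nonneg norm_ge_zero)
  \<comment> \<open>The maximum makes the bound positive, so that \<open>1 / (2 * M)\<close> can
    serve as a tolerance.\<close>
  define M where "M = max M0 1"
  have "0 < M" by (simp add: M_def)
  have M: "hahn_norm d (S x) \<le> M * hahn_norm d x" if "x \<in> hahn_space d" for x
    using M0[OF that] mult_right_mono[OF _ nonneg[OF that], of M0 M] by (simp add: M_def)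
  have "1 \<le> r" by (rule ratio_limit_ge_1[OF pos inc lim])
  have "isCont (symbol a) z"
  proof -
    \<comment> \<open>The midpoint of \<open>r\<close> and \<open>R\<close> lies inside the disk of
      convergence and has modulus larger than that of \<open>z\<close>, giving continuity even when
      \<open>cmod z = r\<close>.\<close>
    have "summable (\<lambda>n. a n * complex_of_real ((r + R) / 2) ^ n)"
      using \<open>1 \<le> r\<close> R by (intro summable_in_conv_radius order_less_le_trans[OF _ R(2)]) (auto simp flip: of_real_add)
    then show ?thesis
      unfolding symbol_def
      by (rule isCont_powser) (use z \<open>1 \<le> r\<close> R in \<open>auto simp flip: of_real_add\<close>)
  qed
  \<comment> \<open>Scaling by \<open>1 - 1 / (n + 1)\<close> pulls \<open>z\<close> strictly inside
    the disk of radius \<open>r\<close>, where evaluation is bounded, while the symbol still tends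
    to \<open>c\<close>.\<close>
  then have lim': "(\<lambda>n. symbol a (complex_of_real (1 - inverse (real (Suc n))) * z)) \<longlonglongrightarrow> c"
    unfolding c_def
    by (rule isCont_tendsto_compose)
      (use tendsto_mult[OF tendsto_of_real[OF LIMSEQ_inverse_real_of_nat_add_minus[of 1]] tendsto_const[of z]] in simp)
  obtain n where n: "dist (symbol a (complex_of_real (1 - inverse (real (Suc n))) * z)) c < 1 / (2 * M)"
    using tendstoD[OF lim', of "1 / (2 * M)"] \<open>0 < M\<close> by (auto simp: eventually_sequentially)
  define w where "w = complex_of_real (1 - inverse (real (Suc n))) * z"
  have w: "cmod w < r"
  proof -
    have "cmod w = (1 - inverse (real (Suc n))) * cmod z"
      unfolding w_def norm_mult norm_of_real by (simp add: divide_simps)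
    also have "\<dots> \<le> (1 - inverse (real (Suc n))) * r"
      using z by (intro mult_left_mono) (auto simp: divide_simps)
    also have "\<dots> < 1 * r"
      using \<open>1 \<le> r\<close> by (intro mult_strict_right_mono) auto
    finally show ?thesis by simp
  qed
  define e where "e = cmod (c - symbol a w)"
  have e: "0 \<le> e" "e * M \<le> 1 / 2"
    using n \<open>0 < M\<close> by (auto simp: e_def w_def dist_norm norm_minus_commute field_simps)
  define K where "K = (\<Sum>n. cmod w ^ n / d n)"
  have K0: "0 \<le> K"
    unfolding K_def using pos
    by (intro suminf_nonneg summable_power_div_weight[OF pos inc lim]) (use w in \<open>auto simp: less_imp_le\<close>)
  have aw: "summable (\<lambda>n. norm (a n * w ^ n))"
    using w R by (intro abs_summable_in_conv_radius order_less_le_trans[OF _ R(2)]) auto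
  have step: "cmod (symbol x w) = e * cmod (symbol (S x) w)" if x: "x \<in> hahn_space d" for x
    using symbol_resolvent_op[OF aw hahn_space_power_functional(1)[OF pos inc lim w SX[OF x]], of c]
    by (simp add: inv[OF x] e_def norm_mult)
  \<comment> \<open>Each replacement of \<open>x\<close> by \<open>S x\<close> gains the factor
    \<open>e * M\<close>, at most 1/2. The induction needs \<open>x\<close> arbitrary, and its limit
    forces the evaluation at \<open>w\<close> to vanish.\<close>
  have small: "cmod (symbol x w) \<le> (1 / 2) ^ m * (K * hahn_norm d x)" if "x \<in> hahn_space d" for x m
    using that
  proof (induction m arbitrary: x)
    case 0
    then show ?case using hahn_space_power_functional(2)[OF pos inc lim w] by (simp add: K_def)
  next
    case (Suc m)
    have "cmod (symbol x w) \<le> e * ((1 / 2) ^ m * (K * hahn_norm d (S x)))"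
      unfolding step[OF Suc.prems] by (intro mult_left_mono Suc.IH SX Suc.prems e)
    also have "\<dots> \<le> e * ((1 / 2) ^ m * (K * (M * hahn_norm d x)))"
      using e K0 M[OF Suc.prems] by (intro mult_left_mono) auto
    also have "\<dots> = (e * M) * ((1 / 2) ^ m * (K * hahn_norm d x))"
      by (simp add: mult_ac)
    also have "\<dots> \<le> (1 / 2) * ((1 / 2) ^ m * (K * hahn_norm d x))"
      using e K0 nonneg[OF Suc.prems] by (intro mult_right_mono) auto
    finally show ?case by simp
  qed
  let ?u = "\<lambda>n. if n = 0 then 1 else 0 :: complex"
  have "(\<lambda>m. (1 / 2) ^ m * (K * hahn_norm d ?u)) \<longlonglongrightarrow> 0 * (K * hahn_norm d ?u)"
    by (intro tendsto_mult tendsto_const LIMSEQ_power_zero) auto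
  then have "cmod (symbol ?u w) \<le> 0"
    using small[OF unit_sequence_in_hahn_space] by (intro LIMSEQ_le_const) auto
  moreover have "symbol ?u w = 1"
    using sums_unique[OF sums_single[of 0 "\<lambda>n. w ^ n"]]
    unfolding symbol_def by (simp add: if_distrib[of "\<lambda>t. t * _"] cong: if_cong)
  ultimately show False by simp
qed

text \<open>The reciprocal of \<open>c - symbol a\<close> is analytic on a disk slightly larger than
  the closed one, so its coefficients are summable against a \<rho> above \<open>r\<close> and
  define a bounded inverse.\<close>

lemma resolvent_outside_symbol_image:
  assumes pos: "\<And>n. 0 < d n" and inc: "incseq d" and unbdd: "\<not> bdd_above (range d)"
    and lim: "(\<lambda>n. d (Suc n) / d n) \<longlonglongrightarrow> r"
    and R: "r < R" "ereal R \<le> conv_radius a" and c: "c \<notin> symbol a ` cball 0 r"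
  shows "c \<notin> op_spectrum (hahn_space d) (hahn_norm d) (convolution_op a)"
proof -
  have "1 \<le> r" by (rule ratio_limit_ge_1[OF pos inc lim])
  define F where "F = fps_const c - Abs_fps a"
  have rF: "ereal R \<le> fps_conv_radius F"
    using order_trans[OF _ fps_conv_radius_diff[of "fps_const c" "Abs_fps a"]] R(2)
    by (simp add: F_def fps_conv_radius_def[of "Abs_fps a"])
  have in_radius: "ereal (cmod z) < fps_conv_radius F" if "cmod z < R" for z
    by (rule order_less_le_trans[OF _ rF]) (simp add: that)
  have evalF: "eval_fps F z = c - symbol a z" if "cmod z < R" for z
    using that R(2) unfolding F_def
    by (subst eval_fps_diff) (auto simp: fps_conv_radius_def[of "Abs_fps a"] eval_fps_def[of "Abs_fps a"] symbol_def
        intro: order_less_le_trans[of _ "ereal R"])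
  have cont: "continuous_on (ball 0 R) (eval_fps F)"
    by (rule continuous_on_subset[OF continuous_on_eval_fps]) (simp add: subset_iff in_radius)
  have "open (ball 0 R \<inter> eval_fps F -` (- {0}))"
    by (rule continuous_open_preimage[OF cont]) auto
  moreover have "cball 0 r \<subseteq> ball 0 R \<inter> eval_fps F -` (- {0})"
    using c R(1) evalF by force
  ultimately obtain e where "0 < e" and e: "(\<Union>x\<in>cball 0 r. ball x e) \<subseteq> ball 0 R \<inter> eval_fps F -` (- {0})"
    using compact_subset_open_imp_ball_epsilon_subset[OF compact_cball] by metis
  \<comment> \<open>Every point of the disk of radius \<open>r + e\<close> is within
    \<open>e\<close> of the closed disk: outside it, the radial projection
    \<open>r / cmod z * z\<close> has distance \<open>cmod z - r\<close>.\<close>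
  have nz: "cmod z < R \<and> eval_fps F z \<noteq> 0" if z: "cmod z < r + e" for z
  proof -
    have "z \<in> (\<Union>x\<in>cball 0 r. ball x e)"
    proof (cases "cmod z \<le> r")
      case True
      with \<open>0 < e\<close> show ?thesis by (intro UN_I[of z]) auto
    next
      case False
      then have "z \<noteq> 0" using \<open>1 \<le> r\<close> by auto
      have "dist (complex_of_real (r / cmod z) * z) z = cmod (complex_of_real (r / cmod z - 1) * z)"
        by (simp add: dist_norm algebra_simps)
      also have "\<dots> = \<bar>r / cmod z - 1\<bar> * cmod z"
        by (simp only: norm_mult norm_of_real)
      also have "\<dots> = cmod z - r"
        using False \<open>z \<noteq> 0\<close> \<open>1 \<le> r\<close> by (simp add: abs_if field_simps)
      finally show ?thesis
        using z \<open>1 \<le> r\<close> \<open>z \<noteq> 0\<close>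
        by (intro UN_I[of "complex_of_real (r / cmod z) * z"]) (auto simp: norm_mult norm_divide)
    qed
    from subsetD[OF e this] show ?thesis by simp
  qed
  \<comment> \<open>The value at 0 is the constant coefficient, so \<open>F\<close> is invertible as
    a formal series.\<close>
  have F0: "fps_nth F 0 \<noteq> 0"
    using nz[of 0] \<open>1 \<le> r\<close> \<open>0 < e\<close> by (simp add: eval_fps_at_0)
  define G where "G = inverse F"
  have GF: "G * F = 1" unfolding G_def by (rule inverse_mult_eq_1[OF F0])
  define \<rho> where "\<rho> = min (r + e / 2) ((r + R) / 2)"
  have \<rho>: "r < \<rho>" "\<rho> < r + e" "\<rho> < R"
    using R(1) \<open>0 < e\<close> by (auto simp: \<rho>_def min_def field_simps)
  have "min (ereal (r + e)) (fps_conv_radius F) \<le> fps_conv_radius G"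
    unfolding G_def
    by (rule fps_conv_radius_inverse) (simp add: nz)
  moreover have "ereal \<rho> < min (ereal (r + e)) (fps_conv_radius F)"
    using \<rho> order_less_le_trans[OF _ rF, of "ereal \<rho>"] by simp
  ultimately have "ereal \<rho> < fps_conv_radius G"
    by (rule order_less_le_trans[rotated])
  then have "ereal (norm (complex_of_real \<rho>)) < conv_radius (fps_nth G)"
    using \<rho> \<open>1 \<le> r\<close> by (simp add: fps_conv_radius_def)
  then have "summable (\<lambda>k. cmod (fps_nth G k) * \<rho> ^ k)"
    using abs_summable_in_conv_radius[of "complex_of_real \<rho>" "fps_nth G"] \<rho> \<open>1 \<le> r\<close>
    by (simp add: norm_mult norm_power)
  then have bounded: "bounded_operator_on (hahn_space d) (hahn_norm d) (convolution_op (fps_nth G))"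
    by (rule convolution_op_bounded[OF pos inc unbdd lim \<rho>(1)])
  \<comment> \<open>Both inverse identities are instances of \<open>G * F = 1\<close> and hold for
    arbitrary sequences.\<close>
  have "convolution_op (fps_nth G) (\<lambda>n. c * x n - convolution_op a x n) = x" for x
    unfolding resolvent_op_eq_fps_mult
    by (simp add: convolution_op_eq_fps_mult F_def[symmetric] mult.assoc[symmetric] GF
        Abs_fps_inverse fps_nth_inverse)
  moreover have "(\<lambda>n. c * convolution_op (fps_nth G) x n
      - convolution_op a (convolution_op (fps_nth G) x) n) = x" for x
    unfolding resolvent_op_eq_fps_mult
    by (simp add: convolution_op_eq_fps_mult F_def[symmetric] mult.assoc[symmetric]
        mult.commute[of F] GF Abs_fps_inverse fps_nth_inverse)
  ultimately show ?thesis
    using bounded unfolding op_spectrum_def by blast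
qed

text \<open>Openness provides a real point \<open>r + e\<close> in \<open>U\<close>, and convergence
  at that single point bounds the radius from below.\<close>

lemma symbol_analytic_near_conv_radius:
  assumes "0 \<le> r" and an: "symbol_analytic_near a (cball 0 r)"
  obtains R where "r < R" "ereal R \<le> conv_radius a"
proof -
  obtain U where "open U" "cball 0 r \<subseteq> U" and s: "\<forall>z\<in>U. summable (\<lambda>n. a n * z ^ n)"
    using an unfolding symbol_analytic_near_def by blast
  then have "complex_of_real r \<in> U" using \<open>0 \<le> r\<close> by auto
  then obtain e where "0 < e" and e: "cball (complex_of_real r) e \<subseteq> U"
    using \<open>open U\<close> open_contains_cball by blast
  have "complex_of_real (r + e) \<in> U"
    using e \<open>0 < e\<close> by (intro subsetD[OF e]) (simp add: dist_norm)
  from conv_radius_geI[OF bspec[OF s this]] have "ereal (r + e) \<le> conv_radius a"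
    using \<open>0 < e\<close> \<open>0 \<le> r\<close> by (simp flip: of_real_add)
  with \<open>0 < e\<close> show thesis by (intro that[of "r + e"]) auto
qed

theorem corollary6p3:
  fixes d :: "nat \<Rightarrow> real" and r :: real and a :: "nat \<Rightarrow> complex"
  assumes "\<And>n. 0 < d n"
    and "incseq d"
    and "\<not> bdd_above (range d)"
    and "(\<lambda>n. d (Suc n) / d n) \<longlonglongrightarrow> r"
    and "a 0 \<noteq> 0"
    and "a 1 \<noteq> 0"
    and "bounded_operator_on (hahn_space d) (hahn_norm d) (convolution_op a)"
    and "symbol_analytic_near a (cball 0 r)"
  shows "op_spectrum (hahn_space d) (hahn_norm d) (convolution_op a) = symbol a ` cball 0 r"
proof -
  have "0 \<le> r" using ratio_limit_ge_1[OF assms(1,2,4)] by simp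
  then obtain R where R: "r < R" "ereal R \<le> conv_radius a"
    using symbol_analytic_near_conv_radius assms(8) by blast
  show ?thesis
    using symbol_in_spectrum[OF assms(1,2,4) R] resolvent_outside_symbol_image[OF assms(1-4) R]
    by auto
qed

end
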